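(* Define, for integers $0\le k\le n$, \[ u(n,k)=\prod_{p\le k,\ p\text{ prime}} p^{v_p\left(\binom{n}{k}\right)}, \] and define $f(n)=\min\{0\le k\le n : u(n,k)>n^2\}$. Then \[ f(n)\le \left(\frac{24}{\pi^2-6}+o(1)\right)(\log n)^2 \le 6.20219\,(\log n)^2 \] for all sufficiently large $n$; that is, for every $\varepsilon>0$ there is $N$ such that $f(n)\le \left(\frac{24}{\pi^2-6}+\varepsilon\right)(\log n)^2$ for all $n\ge N$, and in particular $f(n)\le 6.20219(\log n)^2$ for all sufficiently large $n$. Furthermore, there exists a sequence of positive integers $n_j\to\infty$ such that \[ f(n_j)\ge \left(\tfrac12+o(1)\right)\log n_j \quad (j\to\infty). \]
   Context: $v_p(m)$ denotes the exponent of the prime $p$ in the integer $m$, and $\log$ is the natural logarithm. The product defining $u(n,k)$ is over primes $p\le k$. *)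

theory Defs
  imports Complex_Main "HOL-Computational_Algebra.Primes"
begin

definition u :: "nat \<Rightarrow> nat \<Rightarrow> nat" where
  "u n k = (\<Prod>p | prime p \<and> p \<le> k. p ^ multiplicity p (n choose k))"

definition admissible :: "nat \<Rightarrow> nat set" where
  "admissible n = {k. k \<le> n \<and> u n k > n\<^sup>2}"

text \<open>The set \<open>admissible n\<close> can be empty for small \<open>n\<close> (for instance \<open>n = 1\<close>), and then
  \<open>Min\<close> returns an unspecified value. A claim about \<open>f n\<close> therefore has to come with
  \<open>admissible n \<noteq> {}\<close>.\<close>
definition f :: "nat \<Rightarrow> nat" where
  "f n = Min (admissible n)"

end

theory Submission
  imports Defs "HOL-Number_Theory.Prime_Powers" "HOL-Analysis.Harmonic_Numbers" "HOL-Real_Asymp.Real_Asymp"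
begin

text \<open>By Kummer's theorem, \<open>ln (u n k)\<close> is at least the sum of \<open>mangoldt q\<close> over the prime powers
  \<open>q \<le> k\<close> with \<open>n mod q < k mod q\<close>. Put \<open>b q = q - 1 - n mod q\<close>, so that \<open>q\<close> divides \<open>n + 1 + b q\<close>.
  As \<open>mangoldt\<close> sums to \<open>ln (n + 1 + b)\<close> over the divisors of \<open>n + 1 + b\<close>, the prime powers with
  \<open>b q < s\<close> have total weight at most \<open>s * ln (2 * n)\<close>; most \<open>q\<close> therefore have large \<open>b q\<close>, and each
  yields carries for \<open>b q\<close> values of \<open>k\<close> below every multiple of \<open>q\<close>. Averaging \<open>ln (u n k)\<close> over
  \<open>k \<le> 2 * H\<close> would give the constant \<open>24 / (pi\<^sup>2 - 6)\<close> by means of the prime number theorem. Averaging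
  over \<open>H < k \<le> 2 * H\<close> only is more efficient, to the extent that Chebyshev's elementary bound
  \<open>\<psi> x \<ge> 0.9 * x\<close> already gives the constant 6.

  For the lower bound take \<open>n + 1\<close> to be the square of the least common multiple of \<open>1, \<dots>, k\<close>. Then
  every prime \<open>p \<le> k\<close> has a power above \<open>k\<close> dividing \<open>n + 1\<close>, so there are no carries and \<open>u n j = 1\<close>
  for \<open>j \<le> k\<close>, whereas \<open>ln n \<le> 2 * \<psi> k\<close>. Comparing \<open>ln (x!) = (\<Sum>m. \<psi> (x div m))\<close> with
  \<open>ln (x!) \<le> x * ln x\<close> shows that \<open>\<psi> k \<le> (1 + o(1)) * k\<close> along a suitable sequence of \<open>k\<close>.\<close>

section \<open>Carries\<close>

lemma multiplicity_eq_sum_dvd: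
  fixes p m N :: nat
  assumes "prime p" "0 < m" "m \<le> N"
  shows "multiplicity p m = (\<Sum>j=1..N. of_bool (p ^ j dvd m))"
proof -
  have *: "p ^ j dvd m \<longleftrightarrow> j \<le> multiplicity p m" for j
    using assms power_dvd_iff_le_multiplicity[of m p j] by (auto simp: prime_nat_iff)
  have "multiplicity p m < p ^ multiplicity p m"
    by (rule power_gt_expt) (use prime_gt_1_nat[OF assms(1)] in auto)
  also have "\<dots> \<le> N" using * assms dvd_imp_le[of "p ^ multiplicity p m" m] by force
  finally have "{1..N} \<inter> {j. j \<le> multiplicity p m} = {1..multiplicity p m}" by auto
  then show ?thesis by (simp add: * sum_of_bool_eq)
qed

text \<open>Legendre's formula. The cutoff \<open>N\<close> stays free so that \<open>n\<close>,
  \<open>k\<close> and \<open>n - k\<close> can share one range of exponents.\<close>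

lemma multiplicity_fact:
  fixes p n N :: nat
  assumes "prime p" "n \<le> N"
  shows "multiplicity p (fact n) = (\<Sum>j=1..N. n div p ^ j)"
  using assms(2)
proof (induction n)
  case (Suc n)
  have "multiplicity p (fact (Suc n)) = multiplicity p (Suc n * fact n)" by simp
  also have "\<dots> = multiplicity p (Suc n) + multiplicity p (fact n)"
    using assms(1) by (subst prime_elem_multiplicity_mult_distrib) auto
  also have "\<dots> = (\<Sum>j=1..N. of_bool (p ^ j dvd Suc n) + n div p ^ j)"
    using Suc multiplicity_eq_sum_dvd[OF assms(1), of "Suc n" N] by (simp add: sum.distrib)
  also have "\<dots> = (\<Sum>j=1..N. Suc n div p ^ j)"
    by (intro sum.cong) (auto simp: div_Suc mod_eq_0_iff_dvd)
  finally show ?case .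
qed simp

text \<open>The remainders of \<open>k\<close> and \<open>n - k\<close> sum to less than
  \<open>2 * q\<close>, so there is at most one carry; it occurs exactly when the reduced sum falls
  below \<open>k mod q\<close>.\<close>

lemma div_eq_add_of_bool_carry:
  fixes n k q :: nat
  assumes "k \<le> n" "0 < q"
  shows "n div q = k div q + (n - k) div q + of_bool (n mod q < k mod q)"
proof -
  define a b where "a = k mod q" and "b = (n - k) mod q"
  have ab: "a < q" "b < q" using assms by (auto simp: a_def b_def)
  have n: "n = k + (n - k)" using assms by simp
  have 1: "n div q = k div q + (n - k) div q + (a + b) div q"
    unfolding a_def b_def by (subst n) (rule div_add1_eq)
  have 2: "n mod q = (a + b) mod q"
    unfolding a_def b_def by (subst n) (simp add: mod_add_eq)
  show ?thesis
  proof (cases "a + b < q")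
    case True
    then show ?thesis using 1 2 by (simp add: a_def)
  next
    case False
    then have "(a + b) div q = 1" "(a + b) mod q = a + b - q"
      using ab by (auto simp: div_nat_eqI mod_if le_mod_geq)
    then show ?thesis using 1 2 ab False by (simp add: a_def)
  qed
qed

text \<open>Kummer's theorem, by comparing Legendre's formula for the three factorials.\<close>

lemma multiplicity_binomial_carries:
  fixes p n k :: nat
  assumes "prime p" "k \<le> n"
  shows "multiplicity p (n choose k) = (\<Sum>j=1..n. of_bool (n mod p ^ j < k mod p ^ j))"
proof -
  have "multiplicity p (fact n) = multiplicity p (fact k * fact (n - k) * (n choose k))"
    using binomial_fact_lemma[OF assms(2)] by simp
  also have "\<dots> = multiplicity p (fact k) + multiplicity p (fact (n - k)) + multiplicity p (n choose k)"
    using assms by (subst prime_elem_multiplicity_mult_distrib;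
      (subst prime_elem_multiplicity_mult_distrib)?; auto)
  finally have "(\<Sum>j=1..n. n div p ^ j) =
      (\<Sum>j=1..n. k div p ^ j) + (\<Sum>j=1..n. (n - k) div p ^ j) + multiplicity p (n choose k)"
    using assms multiplicity_fact[OF assms(1), of _ n] by simp
  moreover have "(\<Sum>j=1..n. n div p ^ j) = (\<Sum>j=1..n. k div p ^ j + (n - k) div p ^ j +
      of_bool (n mod p ^ j < k mod p ^ j))"
    using assms prime_gt_0_nat[OF assms(1)] by (intro sum.cong div_eq_add_of_bool_carry) auto
  ultimately show ?thesis by (simp add: sum.distrib)
qed

section \<open>The logarithm of \<open>u\<close>\<close>

lemma ln_u:
  assumes "k \<le> n"
  shows "ln (real (u n k)) = (\<Sum>p | prime p \<and> p \<le> k. real (multiplicity p (n choose k)) * ln (real p))"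
proof -
  have "ln (real (u n k)) = (\<Sum>p | prime p \<and> p \<le> k. ln (real p ^ multiplicity p (n choose k)))"
    unfolding u_def of_nat_prod of_nat_power by (subst ln_prod) (auto simp: prime_gt_0_nat)
  then show ?thesis by (simp add: ln_realpow prime_gt_0_nat)
qed

lemma u_pos: "0 < u n k"
  unfolding u_def by (auto intro!: prod_pos simp: prime_gt_0_nat)

lemma primepow_aprimedivisor_nat:
  fixes q :: nat
  assumes "primepow q"
  shows "prime (aprimedivisor q)" "\<exists>j>0. q = aprimedivisor q ^ j"
proof -
  obtain p k where "prime p" "k > 0" "q = p ^ k" using assms by (auto simp: primepow_def)
  then show "prime (aprimedivisor q)" "\<exists>j>0. q = aprimedivisor q ^ j"
    by (auto simp: aprimedivisor_prime_power)
qed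

text \<open>Carries at powers of small primes that exceed \<open>k\<close> are ignored, hence an inequality.\<close>
lemma ln_u_ge_sum_mangoldt:
  assumes "k \<le> n"
  shows "(\<Sum>q=1..k. mangoldt q * of_bool (n mod q < k mod q)) \<le> ln (real (u n k))"
proof -
  define S T :: "nat set" where "S = {q\<in>{1..k}. primepow q \<and> n mod q < k mod q}" and "T = {p. prime p \<and> p \<le> k}"
  have fin: "finite S" "finite T" by (auto simp: S_def T_def)
  have img: "aprimedivisor ` S \<subseteq> T"
  proof
    fix p assume "p \<in> aprimedivisor ` S"
    then obtain q where q: "primepow q" "q \<le> k" "p = aprimedivisor q" by (auto simp: S_def)
    then have "p dvd q" "q > 0" using primepow_aprimedivisor_nat[OF q(1)] by (auto simp: primepow_gt_0_nat intro: aprimedivisor_dvd')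
    then have "p \<le> q" by (simp add: dvd_imp_le)
    then show "p \<in> T" using q primepow_aprimedivisor_nat[OF q(1)] by (auto simp: T_def)
  qed
  have "(\<Sum>q=1..k. mangoldt q * of_bool (n mod q < k mod q)) = (\<Sum>q\<in>S. ln (real (aprimedivisor q)))"
    by (rule sum.mono_neutral_cong_right) (auto simp: S_def mangoldt_def)
  \<comment> \<open>Prime powers are grouped by their prime; a group injects into the exponents with
    a carry in base \<open>p\<close>, and Kummer's theorem counts these.\<close>
  also have "\<dots> = (\<Sum>p\<in>T. \<Sum>q\<in>{q\<in>S. aprimedivisor q = p}. ln (real (aprimedivisor q)))"
    by (rule sum.group[OF fin img, symmetric])
  also have "\<dots> = (\<Sum>p\<in>T. real (card {q\<in>S. aprimedivisor q = p}) * ln (real p))"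
    by (intro sum.cong) auto
  also have "\<dots> \<le> (\<Sum>p\<in>T. real (multiplicity p (n choose k)) * ln (real p))"
  proof (intro sum_mono mult_right_mono)
    fix p assume p: "p \<in> T"
    have "{q\<in>S. aprimedivisor q = p} \<subseteq> (\<lambda>j. p ^ j) ` {j\<in>{1..n}. n mod p ^ j < k mod p ^ j}"
    proof
      fix q assume q: "q \<in> {q\<in>S. aprimedivisor q = p}"
      then obtain j where j: "j > 0" "q = p ^ j" using primepow_aprimedivisor_nat(2)[of q] by (auto simp: S_def)
      have "j < p ^ j" by (rule power_gt_expt) (use p prime_gt_1_nat[of p] in \<open>auto simp: T_def\<close>)
      also have "\<dots> \<le> n" using q j assms by (auto simp: S_def)
      finally show "q \<in> (\<lambda>j. p ^ j) ` {j\<in>{1..n}. n mod p ^ j < k mod p ^ j}"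
        using j q by (auto simp: S_def)
    qed
    then have "card {q\<in>S. aprimedivisor q = p} \<le> card {j\<in>{1..n}. n mod p ^ j < k mod p ^ j}"
      by (rule surj_card_le[rotated]) auto
    also have "\<dots> = multiplicity p (n choose k)"
      using multiplicity_binomial_carries[of p k n] p assms
      by (simp add: T_def sum_of_bool_eq Int_def del: Collect_conj_eq)
    finally show "real (card {q\<in>S. aprimedivisor q = p}) \<le> real (multiplicity p (n choose k))" by simp
  next
    fix p assume "p \<in> T" then show "0 \<le> ln (real p)" using prime_gt_0_nat[of p] by (auto simp: T_def)
  qed
  also have "\<dots> = ln (real (u n k))" using ln_u[OF assms] by (simp add: T_def)
  finally show ?thesis .
qed

section \<open>Chebyshev's function\<close>

definition chebyshev_psi :: "nat \<Rightarrow> real" where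
  "chebyshev_psi x = (\<Sum>q=1..x. mangoldt q)"

text \<open>Passing to \<open>n + 1\<close> adds \<open>ln (n + 1)\<close>, the sum of
  \<open>mangoldt\<close> over its divisors. A common range up to \<open>x\<close> lets several
  factorials be compared termwise.\<close>

lemma ln_fact_eq_sum_mangoldt:
  assumes "n \<le> x"
  shows "ln (fact n) = (\<Sum>q=1..x. mangoldt q * real (n div q))"
  using assms
proof (induction n)
  case (Suc n)
  have "ln (fact (Suc n) :: real) = ln (real (Suc n)) + ln (fact n)"
    by (simp add: ln_mult del: of_nat_Suc)
  also have "ln (real (Suc n)) = (\<Sum>d | d dvd Suc n. mangoldt d)"
    using mangoldt_sum[of "Suc n", where 'a = real] by simp
  also have "\<dots> = (\<Sum>q=1..x. mangoldt q * of_bool (q dvd Suc n))"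
  proof (rule sum.mono_neutral_cong_left)
    show "{d. d dvd Suc n} \<subseteq> {1..x}"
    proof
      fix d assume "d \<in> {d. d dvd Suc n}"
      then have "d \<le> Suc n" "0 < d" using dvd_pos_nat[of "Suc n" d] by (auto simp: dvd_imp_le)
      then show "d \<in> {1..x}" using Suc.prems by auto
    qed
  qed auto
  also have "\<dots> + ln (fact n) = (\<Sum>q=1..x. mangoldt q * (of_bool (q dvd Suc n) + real (n div q)))"
    using Suc by (simp add: sum.distrib distrib_left)
  also have "\<dots> = (\<Sum>q=1..x. mangoldt q * real (Suc n div q))"
    by (intro sum.cong) (auto simp: div_Suc mod_eq_0_iff_dvd)
  finally show ?case .
qed simp

section \<open>Stirling bounds and Chebyshev's lower estimate\<close>

lemma ln_fact_ge:
  assumes "0 < n"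
  shows "real n * ln (real n) - real n \<le> ln (fact n)"
  using assms
proof (induction n rule: nat_induct_non_zero)
  case (Suc n)
  have "ln (1 + 1 / real n) \<le> 1 / real n" by (rule ln_add_one_self_le_self) simp
  also have "1 + 1 / real n = real (Suc n) / real n" using Suc.hyps by (simp add: field_simps)
  also have "ln \<dots> = ln (real (Suc n)) - ln (real n)" using Suc.hyps by (simp add: ln_div)
  finally have "real n * (ln (real (Suc n)) - ln (real n)) \<le> 1" using Suc.hyps by (simp add: field_simps)
  moreover have "ln (fact (Suc n) :: real) = ln (real (Suc n)) + ln (fact n)"
    by (simp add: ln_mult del: of_nat_Suc)
  ultimately show ?case using Suc.IH by (simp add: algebra_simps)
qed simp

lemma ln_fact_le:
  assumes "0 < n"
  shows "ln (fact n) \<le> real n * ln (real n) - real n + ln (real n) + 1"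
  using assms
proof (induction n rule: nat_induct_non_zero)
  case (Suc n)
  have "ln (real n / real (Suc n)) \<le> real n / real (Suc n) - 1"
    using Suc.hyps by (intro ln_le_minus_one) simp
  also have "ln (real n / real (Suc n)) = ln (real n) - ln (real (Suc n))" using Suc.hyps by (simp add: ln_div)
  finally have "real (Suc n) * (ln (real n) - ln (real (Suc n))) \<le> - 1"
    by (simp add: field_simps)
  moreover have "ln (fact (Suc n) :: real) = ln (real (Suc n)) + ln (fact n)"
    by (simp add: ln_mult del: of_nat_Suc)
  ultimately show ?case using Suc.IH by (simp add: algebra_simps)
qed simp

text \<open>As \<open>30 + 1 = 15 + 10 + 6\<close>, the difference of the two sides depends only on
  \<open>m mod 30\<close>.\<close>

lemma chebyshev_floor_le:
  fixes m :: nat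
  shows "m + m div 30 \<le> m div 2 + m div 3 + m div 5 + 1"
proof -
  define a r where "a = m div 30" and "r = m mod 30"
  have m: "m = 30 * a + r" by (simp add: a_def r_def)
  have "r < 30" by (simp add: r_def)
  moreover have "\<forall>r\<in>set [0..<30]. r \<le> r div 2 + r div 3 + r div 5 + (1 :: nat)" by code_simp
  ultimately have r: "r \<le> r div 2 + r div 3 + r div 5 + 1" by simp
  have "m div 30 = a" "m div 2 = 15 * a + r div 2" "m div 3 = 10 * a + r div 3" "m div 5 = 6 * a + r div 5"
    using \<open>r < 30\<close> unfolding m by auto
  then show ?thesis using r m by simp
qed

text \<open>Chebyshev's inequality, at multiples of 30 to avoid rounding.\<close>
lemma chebyshev_psi_30_ge:
  "ln (fact (30 * y)) + ln (fact y) \<le>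
    ln (fact (15 * y)) + ln (fact (10 * y)) + ln (fact (6 * y)) + chebyshev_psi (30 * y)"
proof -
  define x where "x = 30 * y"
  have "(\<Sum>q=1..x. mangoldt q * (real (x div q) + real (y div q)))
      \<le> (\<Sum>q=1..x. mangoldt q * (real (15 * y div q) + real (10 * y div q) + real (6 * y div q) + 1))"
  proof (intro sum_mono mult_left_mono mangoldt_nonneg)
    fix q assume "q \<in> {1..x}"
    have "(x div q) div 2 = 15 * y div q" "(x div q) div 3 = 10 * y div q"
      "(x div q) div 5 = 6 * y div q" "(x div q) div 30 = y div q"
      unfolding x_def div_mult2_eq[symmetric] using div_mult_mult2[of 2 "15 * y" q] div_mult_mult2[of 3 "10 * y" q]
        div_mult_mult2[of 5 "6 * y" q] div_mult_mult2[of 30 y q]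
      by (simp_all add: mult.commute)
    then show "real (x div q) + real (y div q) \<le>
        real (15 * y div q) + real (10 * y div q) + real (6 * y div q) + 1"
      using chebyshev_floor_le[of "x div q"] by linarith
  qed
  then show ?thesis
    using ln_fact_eq_sum_mangoldt[of _ x]
    by (simp add: distrib_left sum.distrib chebyshev_psi_def x_def)
qed

text \<open>The bracket is \<open>30 ln 30 - 15 ln 15 - 10 ln 10 - 6 ln 6\<close>, the coefficient
  of \<open>y\<close> that Stirling's bounds leave in Chebyshev's inequality. It is at least
  27.5.\<close>

lemma chebyshev_constant_ge: "55 \<le> 2 * (14 * ln 2 + 9 * ln 3 + 5 * ln (5::real))"
proof -
  have "exp (55::real) = exp 1 ^ 55" by (simp flip: exp_of_nat_mult)
  also have "\<dots> \<le> (272/100) ^ 55" using e_less_272 by (intro power_mono) auto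
  also have "\<dots> \<le> (2 ^ 14 * 3 ^ 9 * 5 ^ 5) ^ 2" by (simp add: power_divide)
  finally have "55 \<le> ln ((2 ^ 14 * 3 ^ 9 * 5 ^ 5 :: real) ^ 2)" by (subst ln_ge_iff) auto
  also have "\<dots> = 2 * (14 * ln 2 + 9 * ln 3 + 5 * ln (5::real))"
    by (simp only: ln_realpow ln_mult) (simp add: ln_mult ln_realpow)
  finally show ?thesis .
qed

lemma eventually_chebyshev_psi_30_ge:
  "\<forall>\<^sub>F y in at_top. 27 * real y \<le> chebyshev_psi (30 * y)"
proof -
  \<comment> \<open>The surplus of 27.5 over 27 absorbs the errors of the three upper Stirling
    bounds; \<open>900 = 15 * 10 * 6\<close>.\<close>
  have "\<forall>\<^sub>F y in at_top. 3 * ln (real y) + ln 900 + 3 \<le> real y / 2" by real_asymp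
  then show ?thesis using eventually_gt_at_top[of 0]
  proof eventually_elim
    case (elim y)
    have nums: "ln (6 :: real) = ln 2 + ln 3" "ln (10 :: real) = ln 2 + ln 5" "ln (15 :: real) = ln 3 + ln 5"
      "ln (30 :: real) = ln 2 + ln 3 + ln 5"
      using ln_mult_pos[of 2 "3::real"] ln_mult_pos[of 2 "5::real"] ln_mult_pos[of 3 "5::real"]
        ln_mult_pos[of 6 "5::real"] by simp_all
    have ln_y: "ln (real (c * y)) = ln (real c) + ln (real y)" if "0 < c" for c
      using that elim by (simp add: ln_mult)
    have lns: "ln (real (30 * y)) = ln 2 + ln 3 + ln 5 + ln (real y)"
      "ln (real (15 * y)) = ln 3 + ln 5 + ln (real y)" "ln (real (10 * y)) = ln 2 + ln 5 + ln (real y)"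
      "ln (real (6 * y)) = ln 2 + ln 3 + ln (real y)"
      using ln_y[of 30] ln_y[of 15] ln_y[of 10] ln_y[of 6] nums by simp_all
    have ln_900: "ln (900 :: real) = 2 * (ln 2 + ln 3 + ln 5)"
      using ln_mult_pos[of 30 "30::real"] nums by simp
    note ln_fact_ge[of "30 * y"] ln_fact_ge[of y] ln_fact_le[of "15 * y"] ln_fact_le[of "10 * y"] ln_fact_le[of "6 * y"]
    note bounds = this[unfolded lns]
    have "real y * 55 \<le> real y * (2 * (14 * ln 2 + 9 * ln 3 + 5 * ln 5))"
      by (intro mult_left_mono chebyshev_constant_ge) simp
    then show ?case
      using bounds elim chebyshev_psi_30_ge[of y] ln_900 by (simp add: algebra_simps)
  qed
qed

text \<open>Both sides sum \<open>mangoldt q\<close> over the pairs with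
  \<open>m * q \<le> x\<close>, in the two possible orders.\<close>

lemma ln_fact_eq_sum_chebyshev_psi: "ln (fact x) = (\<Sum>m=1..x. chebyshev_psi (x div m))"
proof -
  have "(\<Sum>m=1..x. chebyshev_psi (x div m)) = (\<Sum>m=1..x. \<Sum>q=1..x. mangoldt q * of_bool (m * q \<le> x))"
  proof (intro sum.cong refl)
    fix m assume m: "m \<in> {1..x}"
    have "q \<le> x div m \<longleftrightarrow> m * q \<le> x" for q
      using m by (simp add: less_eq_div_iff_mult_less_eq mult.commute)
    moreover have "q \<le> x" if "m * q \<le> x" for q
      using le_trans[of q "m * q" x] m that by simp
    ultimately show "chebyshev_psi (x div m) = (\<Sum>q=1..x. mangoldt q * of_bool (m * q \<le> x))"
      unfolding chebyshev_psi_def by (intro sum.mono_neutral_cong_left) auto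
  qed
  also have "\<dots> = (\<Sum>q=1..x. \<Sum>m=1..x. mangoldt q * of_bool (m * q \<le> x))" by (rule sum.swap)
  also have "\<dots> = (\<Sum>q=1..x. mangoldt q * real (x div q))"
  proof (intro sum.cong refl)
    fix q assume q: "q \<in> {1..x}"
    have "m * q \<le> x \<longleftrightarrow> m \<le> x div q" for m
      using q by (simp add: less_eq_div_iff_mult_less_eq)
    then have "{1..x} \<inter> {m. m * q \<le> x} = {1..x div q}"
      by (auto intro: le_trans[OF _ div_le_dividend])
    then have "(\<Sum>m=1..x. of_bool (m * q \<le> x)) = real (x div q)"
      by (simp add: sum_of_bool_eq)
    then show "(\<Sum>m=1..x. mangoldt q * of_bool (m * q \<le> x)) = mangoldt q * real (x div q)"
      by (simp flip: sum_distrib_left)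
  qed
  also have "\<dots> = ln (fact x)" by (rule ln_fact_eq_sum_mangoldt[symmetric]) simp
  finally show ?thesis ..
qed

lemma chebyshev_psi_nonneg: "0 \<le> chebyshev_psi x"
  unfolding chebyshev_psi_def by (intro sum_nonneg mangoldt_nonneg)

text \<open>If \<open>chebyshev_psi k\<close> were at least \<open>c * k\<close> from
  \<open>K\<close> on, the previous identity would make \<open>ln (x!)\<close> about
  \<open>c * x * ln x\<close>, exceeding the trivial bound \<open>x * ln x\<close>.\<close>

lemma chebyshev_psi_liminf_le:
  assumes "1 < c"
  shows "\<exists>k\<ge>k0. chebyshev_psi k < c * real k"
proof (rule ccontr)
  assume "\<not> ?thesis"
  then have psi: "c * real k \<le> chebyshev_psi k" if "k \<ge> Suc k0" for k
    using that by (metis Suc_leD not_le)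
  define K where "K = Suc k0"
  have "\<forall>\<^sub>F M in at_top. real K * ln (real K) + c < (c - 1) * real K * ln (real M)"
    using assms by (simp add: K_def) real_asymp
  then have "\<forall>\<^sub>F M in at_top. 0 < M \<and> real K * ln (real K) + c < (c - 1) * real K * ln (real M)"
    using eventually_gt_at_top[of 0] by eventually_elim auto
  then obtain M where M: "0 < M" "real K * ln (real K) + c < (c - 1) * real K * ln (real M)"
    by (auto simp: eventually_at_top_linorder)
  \<comment> \<open>This makes \<open>x div m\<close> at least \<open>K\<close> for every
    \<open>m \<le> M\<close>, so the assumed bound applies to each term.\<close>
  define x where "x = K * M"
  have K: "0 < K" by (simp add: K_def)
  have "c * (real x * harm M - real M) = (\<Sum>m=1..M. c * (real x / real m - 1))"
    by (simp add: harm_def sum_distrib_left sum_subtractf right_diff_distrib divide_inverse mult_ac)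
  also have "\<dots> \<le> (\<Sum>m=1..M. chebyshev_psi (x div m))"
  proof (intro sum_mono)
    fix m assume m: "m \<in> {1..M}"
    then have "K \<le> x div m" by (simp add: x_def less_eq_div_iff_mult_less_eq)
    then have "c * real (x div m) \<le> chebyshev_psi (x div m)" by (intro psi) (simp add: K_def)
    moreover have "real x / real m - 1 \<le> real (x div m)"
      using real_of_int_floor_gt_diff_one[of "real x / real m"] by (simp add: floor_divide_of_nat_eq)
    ultimately show "c * (real x / real m - 1) \<le> chebyshev_psi (x div m)"
      using mult_left_mono[of "real x / real m - 1" "real (x div m)" c] assms by linarith
  qed
  also have "\<dots> \<le> (\<Sum>m=1..x. chebyshev_psi (x div m))"
    using K by (intro sum_mono2) (auto simp: x_def chebyshev_psi_nonneg)
  also have "\<dots> = ln (fact x)" by (simp add: ln_fact_eq_sum_chebyshev_psi)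
  also have "\<dots> \<le> ln (real x ^ x)"
    using M K fact_le_power[of x, where 'a = real] by (subst ln_le_cancel_iff) (auto simp: x_def)
  also have "\<dots> = real x * (ln (real K) + ln (real M))"
    using M K by (simp add: ln_realpow ln_mult x_def)
  finally have "c * (real x * harm M - real M) \<le> real x * (ln (real K) + ln (real M))" .
  moreover have "c * (real x * ln (real M)) \<le> c * (real x * harm M)"
  proof -
    have "ln (real M) \<le> ln (real M + 1)" using M by simp
    also have "\<dots> \<le> harm M" by (rule ln_le_harm)
    finally show ?thesis using assms by (intro mult_left_mono) auto
  qed
  ultimately have "real M * ((c - 1) * real K * ln (real M)) \<le> real M * (real K * ln (real K) + c)"
    by (simp add: x_def algebra_simps)
  then show False using M by simp
qed

section \<open>The lower bound\<close>

text \<open>The least common multiple of \<open>1, \<dots>, k\<close>, in a form whose logarithm is visibly \<open>chebyshev_psi k\<close>.\<close>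
definition lcm_upto :: "nat \<Rightarrow> nat" where
  "lcm_upto k = (\<Prod>q | primepow q \<and> q \<le> k. aprimedivisor q)"

lemma lcm_upto_pos: "0 < lcm_upto k"
  unfolding lcm_upto_def by (intro prod_pos) (auto dest!: primepow_aprimedivisor_nat(1) simp: prime_gt_0_nat)

lemma ln_lcm_upto: "ln (real (lcm_upto k)) = chebyshev_psi k"
proof -
  have "ln (real (lcm_upto k)) = (\<Sum>q | primepow q \<and> q \<le> k. ln (real (aprimedivisor q)))"
    unfolding lcm_upto_def of_nat_prod
    by (subst ln_prod) (auto dest!: primepow_aprimedivisor_nat(1) simp: prime_gt_0_nat)
  also have "\<dots> = chebyshev_psi k"
    unfolding chebyshev_psi_def
    by (rule sum.mono_neutral_cong_left) (auto simp: mangoldt_def Suc_le_eq primepow_gt_0_nat)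
  finally show ?thesis .
qed

text \<open>Each of \<open>p, p ^ 2, ..., p ^ e\<close> contributes one factor \<open>p\<close> to
  the product.\<close>

lemma prime_power_dvd_lcm_upto:
  assumes "prime p" "p ^ e \<le> k"
  shows "p ^ e dvd lcm_upto k"
proof -
  have "p ^ j \<le> k" if "j \<le> e" for j
    using power_increasing[OF that, of p] assms prime_gt_0_nat[of p] by auto
  then have sub: "(\<lambda>j. p ^ j) ` {1..e} \<subseteq> {q. primepow q \<and> q \<le> k}"
    using assms by auto
  have "inj_on (\<lambda>j. p ^ j) {1..e}"
    using assms prime_gt_1_nat[of p] by (auto intro!: inj_onI)
  then have "(\<Prod>q\<in>(\<lambda>j. p ^ j) ` {1..e}. aprimedivisor q) = p ^ e"
    using assms by (simp add: prod.reindex aprimedivisor_prime_power)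
  then show ?thesis
    using prod_dvd_prod_subset[OF _ sub, of aprimedivisor] by (simp add: lcm_upto_def)
qed

lemma mod_eq_pred_if_dvd_Suc:
  fixes n q :: nat
  assumes "q dvd Suc n"
  shows "n mod q = q - 1"
  using assms by (auto simp: dvd_eq_mod_eq_0 mod_Suc split: if_splits)

text \<open>If \<open>n + 1\<close> is divisible by a power of \<open>p\<close> above \<open>k\<close>, then the low base-\<open>p\<close> digits
  of \<open>n\<close> are all \<open>p - 1\<close> and no carry can occur.\<close>
lemma multiplicity_binomial_eq_0:
  fixes p n k a :: nat
  assumes "prime p" "k \<le> n" "k < p ^ a" "p ^ a dvd Suc n"
  shows "multiplicity p (n choose k) = 0"
proof -
  have "\<not> n mod p ^ j < k mod p ^ j" for j
  proof (cases "j \<le> a")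
    case True
    then have "p ^ j dvd Suc n" using assms(4) le_imp_power_dvd dvd_trans by blast
    then have "n mod p ^ j = p ^ j - 1" by (rule mod_eq_pred_if_dvd_Suc)
    moreover have "k mod p ^ j < p ^ j" using assms(1) prime_gt_0_nat[of p] by simp
    ultimately show ?thesis by linarith
  next
    case False
    then have "p ^ a dvd p ^ j" by (simp add: le_imp_power_dvd)
    then have "n mod p ^ a = (n mod p ^ j) mod p ^ a" by (simp add: mod_mod_cancel)
    also have "\<dots> \<le> n mod p ^ j" by simp
    finally have "p ^ a - 1 \<le> n mod p ^ j" using mod_eq_pred_if_dvd_Suc[OF assms(4)] by simp
    moreover have "k mod p ^ j \<le> k" by simp
    ultimately show ?thesis using assms(3) by linarith
  qed
  then show ?thesis using assms by (simp add: multiplicity_binomial_carries)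
qed

definition extremal :: "nat \<Rightarrow> nat" where
  "extremal k = lcm_upto k ^ 2 - 1"

lemma Suc_extremal: "Suc (extremal k) = lcm_upto k ^ 2"
  using lcm_upto_pos[of k] by (simp add: extremal_def)

text \<open>If \<open>p ^ e\<close> is the largest power up to \<open>k\<close>, then
  \<open>e \<ge> 1\<close>, so squaring gives exponent \<open>2 * e \<ge> e + 1\<close>.\<close>

lemma prime_power_dvd_Suc_extremal:
  assumes "prime p" "p \<le> k"
  obtains a where "k < p ^ a" "p ^ a dvd Suc (extremal k)"
proof -
  obtain e where e: "p ^ e \<le> k" "k < p ^ (e + 1)"
    using ex_power_ivl1[of p k] assms prime_ge_2_nat[of p] by auto
  have "e \<noteq> 0" using e assms by (auto intro: ccontr)
  then have "p ^ (e + 1) \<le> p ^ (e * 2)"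
    using prime_gt_0_nat[OF assms(1)] by (intro power_increasing) auto
  moreover have "(p ^ e) ^ 2 dvd lcm_upto k ^ 2"
    using assms e by (intro dvd_power_same prime_power_dvd_lcm_upto)
  ultimately show thesis using that[of "e * 2"] e by (simp add: Suc_extremal power_mult)
qed

lemma le_extremal:
  assumes "2 \<le> k"
  shows "k \<le> extremal k"
proof -
  obtain a where "k < 2 ^ a" "2 ^ a dvd Suc (extremal k)"
    using prime_power_dvd_Suc_extremal[of 2 k] assms by auto
  then show ?thesis using dvd_imp_le[of "2 ^ a" "Suc (extremal k)"] by linarith
qed

lemma u_extremal:
  assumes "2 \<le> k" "k' \<le> k"
  shows "u (extremal k) k' = 1"
  unfolding u_def
proof (rule prod.neutral, rule ballI)
  fix p assume "p \<in> {p. prime p \<and> p \<le> k'}"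
  then have p: "prime p" "p \<le> k" using assms by auto
  then obtain a where "k < p ^ a" "p ^ a dvd Suc (extremal k)" by (rule prime_power_dvd_Suc_extremal)
  then have "multiplicity p (extremal k choose k') = 0"
    using assms p le_extremal[of k] by (intro multiplicity_binomial_eq_0[of p _ _ a]) auto
  then show "p ^ multiplicity p (extremal k choose k') = 1" by simp
qed

lemma finite_admissible: "finite (admissible n)"
  by (rule finite_subset[of _ "{..n}"]) (auto simp: admissible_def)

lemma f_extremal_ge:
  assumes "2 \<le> k" "admissible (extremal k) \<noteq> {}"
  shows "k \<le> f (extremal k)"
proof -
  have "f (extremal k) \<in> admissible (extremal k)"
    unfolding f_def using assms finite_admissible by (intro Min_in)
  then have "1 < u (extremal k) (f (extremal k))"
    using le_extremal[OF assms(1)] assms(1) by (auto simp: admissible_def intro: le_less_trans[rotated])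
  then show ?thesis using u_extremal[OF assms(1), of "f (extremal k)"] by fastforce
qed

lemma ln_extremal_le:
  assumes "2 \<le> k"
  shows "ln (real (extremal k)) \<le> 2 * chebyshev_psi k"
proof -
  have "ln (real (extremal k)) \<le> ln (real (lcm_upto k ^ 2))"
    using le_extremal[OF assms] assms by (subst ln_le_cancel_iff) (auto simp flip: Suc_extremal)
  also have "\<dots> = 2 * chebyshev_psi k"
    using lcm_upto_pos[of k] by (simp add: ln_realpow ln_lcm_upto)
  finally show ?thesis .
qed

lemma lower_bound_sequence:
  assumes "\<forall>n\<ge>N. admissible n \<noteq> {}"
  shows "\<exists>(n :: nat \<Rightarrow> nat) (e :: nat \<Rightarrow> real).
      (\<forall>j. n j > 0) \<and> filterlim n at_top sequentially \<and> e \<longlonglongrightarrow> 0 \<and>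
      (\<forall>j. admissible (n j) \<noteq> {} \<and> real (f (n j)) \<ge> (1/2 + e j) * ln (real (n j)))"
proof -
  define c :: "nat \<Rightarrow> real" where "c j = 1 + 1 / (real j + 1)" for j
  have c: "1 < c j" for j by (simp add: c_def)
  \<comment> \<open>Here \<open>j\<close> forces divergence, \<open>2\<close> makes \<open>k\<close>
    at most \<open>extremal k\<close>, and \<open>N\<close> secures nonempty admissible
    sets.\<close>
  have "\<exists>k\<ge>j + 2 + N. chebyshev_psi k < c j * real k" for j
    by (rule chebyshev_psi_liminf_le[OF c])
  then obtain k where k: "j + 2 + N \<le> k j" "chebyshev_psi (k j) < c j * real (k j)" for j
    by metis
  define n where "n j = extremal (k j)" for j
  have k2: "2 \<le> k j" for j using k(1)[of j] by simp
  have n: "j + 2 + N \<le> n j" for j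
    using k(1)[of j] le_extremal[OF k2[of j]] by (simp add: n_def)
  \<comment> \<open>Chosen so that \<open>1/2 + e j = 1 / (2 * c j)\<close>, matching
    \<open>ln (n j) \<le> 2 * c j * k j\<close>.\<close>
  define e where "e j = 1 / (2 * c j) - 1 / 2" for j
  show ?thesis
  proof (intro exI conjI allI)
    show "0 < n j" for j using n[of j] by simp
    show "filterlim n at_top sequentially"
      by (rule filterlim_at_top_mono[OF filterlim_ident]) (use n in \<open>auto intro!: always_eventually le_trans[OF _ n]\<close>)
    show "e \<longlonglongrightarrow> 0" unfolding e_def c_def by real_asymp
    show adm: "admissible (n j) \<noteq> {}" for j using assms n[of j] by simp
    show "(1 / 2 + e j) * ln (real (n j)) \<le> real (f (n j))" for j
    proof -
      have "ln (real (n j)) \<le> 2 * c j * real (k j)"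
        using ln_extremal_le[OF k2[of j]] k(2)[of j] by (simp add: n_def)
      then have "(1 / 2 + e j) * ln (real (n j)) \<le> real (k j)"
        using c[of j] by (simp add: e_def field_simps)
      then show ?thesis using f_extremal_ge[OF k2[of j]] adm[of j] by (simp add: n_def)
    qed
  qed
qed

section \<open>The upper bound\<close>

text \<open>With \<open>b = q - 1 - n mod q\<close>, the least multiple of \<open>q\<close> above \<open>n\<close> is \<open>n + 1 + b\<close>,
  and \<open>k\<close> produces a carry iff it lies at most \<open>b\<close> below a multiple \<open>m * q\<close>.\<close>
lemma card_carries_window_ge:
  fixes n q H B :: nat
  assumes "0 < q" "q \<le> H"
  shows "(2 * H div q - H div q) * min (q - 1 - n mod q) B
    \<le> card {k\<in>{H - B..2 * H}. q \<le> k \<and> n mod q < k mod q}"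
proof -
  \<comment> \<open>\<open>?M\<close> indexes the multiples of \<open>q\<close> in
    \<open>(H, 2 * H]\<close>, \<open>?S\<close> the distances below them. Quotient and remainder of
    \<open>m * q - s\<close> recover the pair.\<close>
  let ?M = "{H div q<..2 * H div q}" and ?S = "{1..min (q - 1 - n mod q) B}"
  let ?g = "\<lambda>(m, s). m * q - s"
  have ms: "m * q - s = (m - 1) * q + (q - s) \<and> q - s < q \<and> H < m * q \<and> m * q \<le> 2 * H \<and> 2 \<le> m \<and> s < q"
    if "m \<in> ?M" "s \<in> ?S" for m s
  proof -
    have "H < m * q" "m * q \<le> 2 * H"
      using that assms by (auto simp: div_less_iff_less_mult less_eq_div_iff_mult_less_eq)
    moreover have "2 \<le> m"
      using \<open>H < m * q\<close> assms by (cases m; cases "m - 1") auto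
    moreover have "s < q" using that assms by auto
    moreover obtain m' where "m = Suc m'" using \<open>2 \<le> m\<close> by (cases m) auto
    ultimately show ?thesis using that by auto
  qed
  have dm: "(m * q - s) div q = m - 1 \<and> (m * q - s) mod q = q - s" if "m \<in> ?M" "s \<in> ?S" for m s
  proof -
    obtain r where r: "r = q - s" by blast
    show ?thesis using ms[OF that, folded r] by (simp flip: r)
  qed
  have "inj_on ?g (?M \<times> ?S)"
  proof (rule inj_onI, clarify)
    fix m s m' s' assume *: "m \<in> ?M" "s \<in> ?S" "m' \<in> ?M" "s' \<in> ?S" "m * q - s = m' * q - s'"
    have "m - 1 = m' - 1" "q - s = q - s'"
      using dm[OF *(1,2)] dm[OF *(3,4)] *(5) by simp_all
    then show "m = m' \<and> s = s'" using ms[OF *(1,2)] ms[OF *(3,4)] by linarith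
  qed
  moreover have "?g ` (?M \<times> ?S) \<subseteq> {k\<in>{H - B..2 * H}. q \<le> k \<and> n mod q < k mod q}"
  proof (clarify, intro CollectI conjI)
    fix m s assume *: "m \<in> ?M" "s \<in> ?S"
    note msd = ms[OF *] dm[OF *]
    have "s \<le> B" using * by simp
    then have "H - B \<le> m * q - s" "m * q - s \<le> 2 * H" using msd by linarith+
    then show "m * q - s \<in> {H - B..2 * H}" by simp
    have "1 * q \<le> (m - 1) * q" using msd by (intro mult_le_mono1) linarith
    then show "q \<le> m * q - s" using msd by linarith
    have "1 \<le> s" "s \<le> q - 1 - n mod q" using * by auto
    then have "n mod q < q - s" by linarith
    then show "n mod q < (m * q - s) mod q" using msd by simp
  qed
  ultimately have "card (?M \<times> ?S) \<le> card {k\<in>{H - B..2 * H}. q \<le> k \<and> n mod q < k mod q}"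
    by (rule card_inj_on_le) simp
  then show ?thesis by (simp add: card_cartesian_product)
qed

lemma sum_mangoldt_short_gap_le:
  assumes "0 < n" "s \<le> n"
  shows "(\<Sum>q=1..x. mangoldt q * of_bool (q - 1 - n mod q < s)) \<le> real s * ln (real (2 * n))"
proof -
  have dvd: "q dvd n + 1 + (q - 1 - n mod q)" if "0 < q" for q
  proof -
    have "n mod q < q" using that by simp
    then have "n + 1 + (q - 1 - n mod q) = n div q * q + q"
      using div_mult_mod_eq[of n q] by linarith
    then show ?thesis by simp
  qed
  have "(\<Sum>q=1..x. mangoldt q * of_bool (q - 1 - n mod q < s))
      \<le> (\<Sum>q=1..x. mangoldt q * (\<Sum>b<s. of_bool (q dvd n + 1 + b)) :: real)"
  proof (intro sum_mono mult_left_mono mangoldt_nonneg)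
    fix q assume q: "q \<in> {1..x}"
    show "of_bool (q - 1 - n mod q < s) \<le> (\<Sum>b<s. of_bool (q dvd n + 1 + b) :: real)"
    proof (cases "q - 1 - n mod q < s")
      case True
      then show ?thesis
        using member_le_sum[of "q - 1 - n mod q" "{..<s}" "\<lambda>b. of_bool (q dvd n + 1 + b) :: real"]
          dvd[of q] q by simp
    qed (simp add: sum_nonneg)
  qed
  also have "\<dots> = (\<Sum>b<s. \<Sum>q=1..x. mangoldt q * of_bool (q dvd n + 1 + b))"
    by (simp only: sum_distrib_left) (rule sum.swap)
  also have "\<dots> \<le> (\<Sum>b<s. ln (real (2 * n)))"
  proof (intro sum_mono)
    fix b assume b: "b \<in> {..<s}"
    have "(\<Sum>q=1..x. mangoldt q * of_bool (q dvd n + 1 + b))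
        = (\<Sum>q\<in>{q\<in>{1..x}. q dvd n + 1 + b}. mangoldt q :: real)"
      by (intro sum.mono_neutral_cong_right) auto
    also have "\<dots> \<le> (\<Sum>q | q dvd n + 1 + b. mangoldt q)"
      by (intro sum_mono2) (auto simp: mangoldt_nonneg)
    also have "\<dots> = ln (real (n + 1 + b))"
      using mangoldt_sum[of "n + 1 + b", where 'a = real] by simp
    also have "\<dots> \<le> ln (real (2 * n))"
      using b assms by (subst ln_le_cancel_iff) auto
    finally show "(\<Sum>q=1..x. mangoldt q * of_bool (q dvd n + 1 + b)) \<le> ln (real (2 * n))" .
  qed
  finally show ?thesis by simp
qed

lemma sum_mangoldt_long_gap_ge:
  assumes "0 < n" "s \<le> n"
  shows "chebyshev_psi x - real s * ln (real (2 * n))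
    \<le> (\<Sum>q=1..x. mangoldt q * of_bool (s \<le> q - 1 - n mod q))"
proof -
  have "chebyshev_psi x = (\<Sum>q=1..x. mangoldt q * of_bool (s \<le> q - 1 - n mod q)
      + mangoldt q * of_bool (q - 1 - n mod q < s))"
    unfolding chebyshev_psi_def by (intro sum.cong) auto
  then show ?thesis using sum_mangoldt_short_gap_le[OF assms, of x] by (simp add: sum.distrib)
qed

text \<open>The main term is the area of a triangle with height \<open>P\<close> and base
  \<open>P / l\<close>; \<open>P / 2\<close> pays for replacing the integral by a sum.\<close>

lemma sum_max_linear_ge:
  fixes P l :: real
  assumes "0 < l" "0 \<le> P" "P \<le> real B * l"
  shows "P\<^sup>2 / (2 * l) - P / 2 \<le> (\<Sum>s=1..B. max 0 (P - real s * l))"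
proof -
  define S where "S = nat \<lfloor>P / l\<rfloor>"
  have S: "real S \<le> P / l" "P / l < real S + 1" using assms by (auto simp: S_def)
  have "P / l \<le> real B" using assms by (simp add: field_simps)
  then have "S \<le> B" using S by linarith
  \<comment> \<open>This product is \<open>2 * l\<close> times the slack in the next
    inequality.\<close>
  have "0 \<le> (P - real S * l) * ((real S + 1) * l - P)"
    using S assms by (intro mult_nonneg_nonneg) (auto simp: field_simps)
  then have "P\<^sup>2 / (2 * l) - P / 2 \<le> real S * P - l * (real S * (real S + 1) / 2)"
    using assms by (simp add: field_simps power2_eq_square)
  also have "\<dots> = (\<Sum>s=1..S. P - real s * l)"
    using double_gauss_sum_from_Suc_0[of S, where 'a = real] 
    by (simp add: sum_subtractf flip: sum_distrib_right)
  also have "\<dots> \<le> (\<Sum>s=1..S. max 0 (P - real s * l))" by (intro sum_mono) simp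
  also have "\<dots> \<le> (\<Sum>s=1..B. max 0 (P - real s * l))"
    using \<open>S \<le> B\<close> by (intro sum_mono2) auto
  finally show ?thesis .
qed

text \<open>The right-hand side is \<open>(z + 1) div 2\<close> for \<open>z = 2 * H div q\<close>, which jumps at odd \<open>z\<close>. Only \<open>q \<le> H\<close>
  will occur, so the jump at \<open>z = 1\<close> is counted at \<open>z = 2\<close>; those beyond \<open>z = 7\<close> can be dropped.\<close>
lemma multiples_window_ge:
  fixes H q :: nat
  assumes "0 < q"
  shows "(\<Sum>m\<in>{2,3,5,7}. of_bool (m * q \<le> 2 * H)) \<le> 2 * H div q - H div q"
proof -
  define z where "z = 2 * H div q"
  have "m * q \<le> 2 * H \<longleftrightarrow> m \<le> z" for m
    using assms by (simp add: z_def less_eq_div_iff_mult_less_eq)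
  moreover have "H div q = z div 2"
    using div_mult_mult1[of 2 H q] by (simp add: z_def div_mult2_eq[symmetric] mult.commute)
  ultimately have "(\<Sum>m\<in>{2,3,5,7}. of_bool (m * q \<le> 2 * H))
      = of_bool (2 \<le> z) + of_bool (3 \<le> z) + of_bool (5 \<le> z) + (of_bool (7 \<le> z) :: nat)"
    by (simp del: sum_of_bool_eq)
  also have "\<dots> \<le> z - z div 2"
    by (auto simp: of_bool_def)
  finally show ?thesis using \<open>H div q = z div 2\<close> by (simp flip: z_def)
qed

text \<open>Writing \<open>min (b q) B\<close> as a sum over thresholds \<open>s \<le> B\<close>
  reduces the carry count to the long-gap estimate for each \<open>s\<close> and \<open>m\<close>.
  The bound \<open>P m \<le> B * ln (2 * n)\<close> lets \<open>s\<close> run until the linear lower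
  bound vanishes.\<close>

lemma sum_ln_u_window_ge:
  fixes P :: "nat \<Rightarrow> real"
  assumes "0 < n" "2 * H \<le> n" "B \<le> n"
    and P: "\<And>m. m \<in> {2,3,5,7} \<Longrightarrow> 0 \<le> P m \<and> P m \<le> chebyshev_psi (2 * H div m) \<and> P m \<le> real B * ln (real (2 * n))"
  shows "(\<Sum>m\<in>{2,3,5,7}. (P m)\<^sup>2 / (2 * ln (real (2 * n))) - P m / 2) \<le> (\<Sum>k=H-B..2*H. ln (real (u n k)))"
proof -
  let ?l = "ln (real (2 * n))" and ?b = "\<lambda>q. q - 1 - n mod q" and ?M = "{2,3,5,7::nat}"
  have l: "0 < ?l" using assms(1) by simp
  have "(\<Sum>m\<in>?M. (P m)\<^sup>2 / (2 * ?l) - P m / 2)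
      \<le> (\<Sum>m\<in>?M. \<Sum>s=1..B. max 0 (P m - real s * ?l))"
    using P by (intro sum_mono sum_max_linear_ge l) auto
  also have "\<dots> \<le> (\<Sum>m\<in>?M. \<Sum>s=1..B. \<Sum>q=1..H. mangoldt q * of_bool (s \<le> ?b q \<and> m * q \<le> 2 * H))"
  proof (intro sum_mono)
    fix m s assume m: "m \<in> ?M" and s: "s \<in> {1..B}"
    have "P m - real s * ?l \<le> chebyshev_psi (2 * H div m) - real s * ?l" using P[OF m] by simp
    also have "\<dots> \<le> (\<Sum>q=1..2 * H div m. mangoldt q * of_bool (s \<le> ?b q))"
      using s assms by (intro sum_mangoldt_long_gap_ge) auto
    also have "\<dots> = (\<Sum>q=1..H. mangoldt q * of_bool (s \<le> ?b q \<and> m * q \<le> 2 * H))"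
      using m by (intro sum.mono_neutral_cong_left) (auto simp: less_eq_div_iff_mult_less_eq mult.commute)
    finally show "max 0 (P m - real s * ?l) \<le> \<dots>"
      by (simp add: sum_nonneg mangoldt_nonneg)
  qed
  also have "\<dots> = (\<Sum>m\<in>?M. \<Sum>q=1..H. \<Sum>s=1..B. mangoldt q * of_bool (s \<le> ?b q \<and> m * q \<le> 2 * H))"
    by (intro sum.cong refl sum.swap)
  also have "\<dots> = (\<Sum>q=1..H. \<Sum>m\<in>?M. \<Sum>s=1..B. mangoldt q * of_bool (s \<le> ?b q \<and> m * q \<le> 2 * H))"
    by (rule sum.swap)
  also have "\<dots> = (\<Sum>q=1..H. mangoldt q * real ((\<Sum>m\<in>?M. of_bool (m * q \<le> 2 * H)) * min (?b q) B))"
  proof (intro sum.cong refl)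
    fix q
    have "(\<Sum>s=1..B. of_bool (s \<le> ?b q)) = real (min (?b q) B)"
    proof -
      have "{1..B} \<inter> {s. s \<le> ?b q} = {1..min (?b q) B}" by auto
      then show ?thesis by (simp add: sum_of_bool_eq)
    qed
    then show "(\<Sum>m\<in>?M. \<Sum>s=1..B. mangoldt q * of_bool (s \<le> ?b q \<and> m * q \<le> 2 * H))
        = mangoldt q * real ((\<Sum>m\<in>?M. of_bool (m * q \<le> 2 * H)) * min (?b q) B)"
      by (simp only: of_bool_conj of_nat_mult of_nat_sum of_nat_of_bool sum_distrib_left[symmetric]
        sum_distrib_right[symmetric]) (simp only: mult_ac)
  qed
  also have "\<dots> \<le> (\<Sum>q=1..H. mangoldt q * real (card {k\<in>{H - B..2 * H}. q \<le> k \<and> n mod q < k mod q}))"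
  proof (intro sum_mono mult_left_mono mangoldt_nonneg)
    fix q assume q: "q \<in> {1..H}"
    have "(\<Sum>m\<in>?M. of_bool (m * q \<le> 2 * H)) * min (?b q) B \<le> (2 * H div q - H div q) * min (?b q) B"
      using q by (intro mult_le_mono1 multiples_window_ge) simp
    also have "\<dots> \<le> card {k\<in>{H - B..2 * H}. q \<le> k \<and> n mod q < k mod q}"
      using q by (intro card_carries_window_ge) auto
    finally show "real ((\<Sum>m\<in>?M. of_bool (m * q \<le> 2 * H)) * min (?b q) B)
        \<le> real (card {k\<in>{H - B..2 * H}. q \<le> k \<and> n mod q < k mod q})"
      by (rule of_nat_mono)
  qed
  also have "\<dots> = (\<Sum>q=1..H. \<Sum>k=H-B..2*H. mangoldt q * of_bool (q \<le> k \<and> n mod q < k mod q))"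
  proof (intro sum.cong refl)
    fix q
    have "{H-B..2*H} \<inter> {k. q \<le> k \<and> n mod q < k mod q} = {k\<in>{H - B..2 * H}. q \<le> k \<and> n mod q < k mod q}"
      by auto
    then show "mangoldt q * real (card {k\<in>{H - B..2 * H}. q \<le> k \<and> n mod q < k mod q})
        = (\<Sum>k=H-B..2*H. mangoldt q * of_bool (q \<le> k \<and> n mod q < k mod q))"
      by (simp only: sum_distrib_left[symmetric] sum_of_bool_eq finite_atLeastAtMost)
  qed
  also have "\<dots> = (\<Sum>k=H-B..2*H. \<Sum>q=1..H. mangoldt q * of_bool (q \<le> k \<and> n mod q < k mod q))"
    by (rule sum.swap)
  also have "\<dots> \<le> (\<Sum>k=H-B..2*H. ln (real (u n k)))"
  proof (intro sum_mono)
    fix k assume k: "k \<in> {H-B..2*H}"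
    have "(\<Sum>q=1..H. mangoldt q * of_bool (q \<le> k \<and> n mod q < k mod q))
        = (\<Sum>q\<in>{q\<in>{1..k}. q \<le> H}. mangoldt q * of_bool (n mod q < k mod q) :: real)"
      by (intro sum.mono_neutral_cong_right) auto
    also have "\<dots> \<le> (\<Sum>q=1..k. mangoldt q * of_bool (n mod q < k mod q))"
      by (intro sum_mono2) (auto simp: mangoldt_nonneg)
    also have "\<dots> \<le> ln (real (u n k))"
      using k assms by (intro ln_u_ge_sum_mangoldt) auto
    finally show "(\<Sum>q=1..H. mangoldt q * of_bool (q \<le> k \<and> n mod q < k mod q)) \<le> ln (real (u n k))" .
  qed
  finally show ?thesis .
qed

text \<open>Since \<open>6300 = 30 * 210\<close>, each \<open>6300 * y div m\<close> with \<open>m\<close> in \<open>{2, 3, 5, 7}\<close> is a multiple of 30,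
  and \<open>13551381 = 2835\<^sup>2 + 1890\<^sup>2 + 1134\<^sup>2 + 810\<^sup>2\<close> collects the squares of the values \<open>27 * 210 * y / m\<close>.\<close>
lemma exists_admissible_le:
  assumes n: "0 < n" "1 \<le> ln (real n)" and y: "0 < y" "6300 * y \<le> n"
    and psi: "\<And>c. c \<in> {30, 42, 70, 105} \<Longrightarrow> 27 * real (c * y) \<le> chebyshev_psi (30 * (c * y))"
    and big: "12608 * ln (real n) * ln (real (2 * n)) + 11340 * ln (real n) + 6669 * ln (real (2 * n))
      < 13551381 * real y"
  shows "\<exists>k\<in>admissible n. k \<le> 6300 * y"
proof (rule ccontr)
  assume "\<not> ?thesis"
  then have u_le: "u n k \<le> n\<^sup>2" if "k \<le> 6300 * y" for k
  proof -
    have "k \<le> n" using that y by linarith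
    then show ?thesis using \<open>\<not> _\<close> that by (auto simp: admissible_def not_less)
  qed
  define L l where "L = ln (real n)" and "l = ln (real (2 * n))"
  define H where "H = 3150 * y"
  \<comment> \<open>The largest \<open>P m\<close> is \<open>P 2 = 27 * 105 * y = 2835 * y\<close>,
    and \<open>B * l\<close> has to reach it.\<close>
  define B where "B = nat \<lceil>2835 * real y / l\<rceil>"
  define P :: "nat \<Rightarrow> real" where "P m = 27 * real (210 div m * y)" for m
  have L: "1 \<le> L" "L \<le> l" using n by (auto simp: L_def l_def)
  have B: "2835 * real y / l \<le> real B" "real B \<le> 2835 * real y / l + 1"
    using L by (auto simp: B_def)
  have "2835 * real y / l \<le> 2835 * real y" using L mult_left_mono[of 1 l "real y"] by (simp add: field_simps)
  then have "real B \<le> real n" using B y by linarith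
  then have "B \<le> n" by simp
  have l_B: "2835 * real y \<le> real B * l" using B L by (simp add: field_simps)
  have "(\<Sum>m\<in>{2,3,5,7}. (P m)\<^sup>2 / (2 * l) - P m / 2) \<le> (\<Sum>k=H-B..2*H. ln (real (u n k)))"
    unfolding l_def
  proof (rule sum_ln_u_window_ge)
    fix m :: nat assume m: "m \<in> {2,3,5,7}"
    then have div: "2 * H div m = 30 * (210 div m * y)" unfolding H_def by (elim insertE emptyE; simp; presburger?)
    have c: "210 div m \<in> {30, 42, 70, 105}" using m by auto
    then have "real (210 div m * y) \<le> 105 * real y" by auto
    then have "P m \<le> real B * l" using l_B by (simp only: P_def)
    then show "0 \<le> P m \<and> P m \<le> chebyshev_psi (2 * H div m) \<and> P m \<le> real B * ln (real (2 * n))"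
      using psi[OF c] unfolding div P_def l_def by simp
  qed (use n y \<open>B \<le> n\<close> in \<open>auto simp: H_def\<close>)
  also have "\<dots> \<le> (\<Sum>k=H-B..2*H. 2 * L)"
  proof (intro sum_mono)
    fix k assume "k \<in> {H-B..2*H}"
    then have "real (u n k) \<le> real n ^ 2"
      using u_le[of k] by (simp add: H_def flip: of_nat_power)
    then have "ln (real (u n k)) \<le> ln (real n ^ 2)"
      using u_pos[of n k] n by (subst ln_le_cancel_iff) auto
    then show "ln (real (u n k)) \<le> 2 * L" using n by (simp add: L_def ln_realpow)
  qed
  also have "\<dots> = real (card {H-B..2*H}) * (2 * L)" by simp
  \<comment> \<open>The window has at most \<open>H + B + 1\<close> elements, and rounding in
    \<open>B\<close> costs one more.\<close>
  also have "\<dots> \<le> (3150 * real y + 2835 * real y / l + 2) * (2 * L)"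
    using B L by (intro mult_right_mono) (auto simp: H_def of_nat_diff)
  also have "\<dots> \<le> (3152 * real y + 2835 * real y / l) * (2 * L)"
    using y L by (intro mult_right_mono) auto
  finally have "13551381 * (real y)\<^sup>2 / (2 * l) - 6669 * real y / 2 \<le> (3152 * real y + 2835 * real y / l) * (2 * L)"
    by (simp add: P_def power_mult_distrib add_divide_distrib[symmetric])
  \<comment> \<open>Clearing \<open>2 * l\<close> turns 3152 and 2835 into 12608 and 11340; 6669 is
    \<open>2835 + 1890 + 1134 + 810\<close>.\<close>
  then have "(l * real y) * (13551381 * real y) \<le> (l * real y) * (12608 * L * l + 11340 * L + 6669 * l)"
    using L by (simp add: field_simps power2_eq_square)
  then have "13551381 * real y \<le> 12608 * L * l + 11340 * L + 6669 * l"
    using L y by (subst (asm) mult_le_cancel_left_pos) auto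
  then show False using big by (simp add: L_def l_def)
qed

lemma f_le:
  assumes "k \<in> admissible n"
  shows "f n \<le> k"
  unfolding f_def using assms finite_admissible by (rule Min_le[rotated])

text \<open>With \<open>y = (ln n)\<^sup>2 / 1050\<close> the condition of the previous lemma amounts to
  \<open>12608 < 13551381 / 1050\<close>.\<close>
lemma eventually_f_le:
  "\<forall>\<^sub>F n in at_top. admissible n \<noteq> {} \<and> real (f n) \<le> 6 * (ln (real n))\<^sup>2"
proof -
  obtain y0 where y0: "27 * real y \<le> chebyshev_psi (30 * y)" if "y0 \<le> y" for y
    using eventually_chebyshev_psi_30_ge by (auto simp: eventually_at_top_linorder)
  \<comment> \<open>The \<open>- 1\<close> allows for the floor in \<open>y\<close>.\<close>
  have "\<forall>\<^sub>F n in at_top. 0 < n \<and> 1 \<le> ln (real n) \<and> 6 * (ln (real n))\<^sup>2 \<le> real n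
    \<and> real y0 + 1 \<le> (ln (real n))\<^sup>2 / 1050 - 1
    \<and> 12608 * ln (real n) * ln (real (2 * n)) + 11340 * ln (real n) + 6669 * ln (real (2 * n))
      < 13551381 * ((ln (real n))\<^sup>2 / 1050 - 1)"
    by (intro eventually_conj eventually_gt_at_top) real_asymp+
  then show ?thesis
  proof eventually_elim
    case (elim n)
    define y where "y = nat \<lfloor>(ln (real n))\<^sup>2 / 1050\<rfloor>"
    have y: "real y \<le> (ln (real n))\<^sup>2 / 1050" "(ln (real n))\<^sup>2 / 1050 - 1 < real y"
      by (auto simp: y_def) linarith
    have "6300 * real y \<le> real n" using y elim by linarith
    moreover have "y0 < y" using y elim by linarith
    ultimately have "\<exists>k\<in>admissible n. k \<le> 6300 * y"
      using elim y by (intro exists_admissible_le y0) (auto simp: le_trans)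
    then obtain k where k: "k \<in> admissible n" "k \<le> 6300 * y" by blast
    then have "real (f n) \<le> 6300 * real y" using f_le[OF k(1)] by linarith
    also have "\<dots> \<le> 6 * (ln (real n))\<^sup>2" using y by linarith
    finally show ?case using k by auto
  qed
qed

theorem theorem2p1:
  "(\<forall>\<epsilon>>0. \<exists>N. \<forall>n\<ge>N. admissible n \<noteq> {} \<and>
      real (f n) \<le> (24 / (pi\<^sup>2 - 6) + \<epsilon>) * (ln (real n))\<^sup>2) \<and>
   (\<exists>N. \<forall>n\<ge>N. admissible n \<noteq> {} \<and>
      real (f n) \<le> 6.20219 * (ln (real n))\<^sup>2) \<and>
   (\<exists>(n :: nat \<Rightarrow> nat) (e :: nat \<Rightarrow> real).
      (\<forall>j. n j > 0) \<and> filterlim n at_top sequentially \<and> e \<longlonglongrightarrow> 0 \<and>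
      (\<forall>j. admissible (n j) \<noteq> {} \<and> real (f (n j)) \<ge> (1/2 + e j) * ln (real (n j))))"
proof -
  obtain N where N: "admissible n \<noteq> {} \<and> real (f n) \<le> 6 * (ln (real n))\<^sup>2" if "N \<le> n" for n
    using eventually_f_le by (auto simp: eventually_at_top_linorder)
  have upper: "\<exists>N. \<forall>n\<ge>N. admissible n \<noteq> {} \<and> real (f n) \<le> c * (ln (real n))\<^sup>2" if "6 \<le> c" for c
  proof (intro exI[of _ N] allI impI conjI)
    fix n assume n: "N \<le> n"
    show "admissible n \<noteq> {}" using N[OF n] by blast
    have "6 * (ln (real n))\<^sup>2 \<le> c * (ln (real n))\<^sup>2" using that by (intro mult_right_mono) auto
    then show "real (f n) \<le> c * (ln (real n))\<^sup>2" using N[OF n] by linarith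
  qed
  have "3 \<le> pi" "pi \<le> 3.15" using pi_approx by (auto simp: abs_if split: if_splits)
  then have "9 \<le> pi\<^sup>2" "pi\<^sup>2 \<le> 10"
    using power_mono[of 3 pi 2] power_mono[of pi "3.15" 2] by (auto simp: power2_eq_square)
  then have "6 \<le> 24 / (pi\<^sup>2 - 6)" by (simp add: field_simps)
  then have "\<forall>\<epsilon>>0. \<exists>N. \<forall>n\<ge>N. admissible n \<noteq> {} \<and>
      real (f n) \<le> (24 / (pi\<^sup>2 - 6) + \<epsilon>) * (ln (real n))\<^sup>2"
    by (intro allI impI upper) linarith
  moreover have "\<exists>N. \<forall>n\<ge>N. admissible n \<noteq> {} \<and> real (f n) \<le> 6.20219 * (ln (real n))\<^sup>2"
    by (rule upper) simp
  ultimately show ?thesis using lower_bound_sequence[of N] N by blast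
qed

end
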